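(* There is an algorithm which, in exact arithmetic, given a generic matrix $A\in\mathbb{C}^{n\times n}$, computes using $O(n^3)$ arithmetic operations $2n$ Toeplitz matrices $T_1,\dots,T_{2n}\in\mathbb{C}^{n\times n}$ and $n$ permutation matrices $P_1,\dots,P_n\in\mathbb{C}^{n\times n}$ such that \[ A=T_1T_2P_1T_3T_4P_2\cdots T_{2n-1}T_{2n}P_n. \]
   Context: A matrix $(a_{ij})$ is Toeplitz if $a_{ij}$ depends only on $j-i$. "For a generic $A$" means that the Zariski closure of the set of matrices $A\in\mathbb{C}^{n\times n}$ for which the property fails is a proper closed subset of $\mathbb{C}^{n\times n}$. Complexity is counted in arithmetic operations on complex numbers, all performed exactly. *)

theory Defs
  imports "Jordan_Normal_Form.Matrix" "HOL-Library.Landau_Symbols" "HOL-Combinatorics.Permutations"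
begin

section \<open>Toeplitz and permutation matrices\<close>

definition toeplitz_mat :: "nat \<Rightarrow> complex mat \<Rightarrow> bool" where
  "toeplitz_mat n M \<longleftrightarrow> M \<in> carrier_mat n n \<and>
     (\<forall>i<n. \<forall>j<n. \<forall>k<n. \<forall>l<n. int j - int i = int l - int k \<longrightarrow> M $$ (i, j) = M $$ (k, l))"

definition permutation_mat :: "nat \<Rightarrow> complex mat \<Rightarrow> bool" where
  "permutation_mat n M \<longleftrightarrow>
     (\<exists>\<pi>. \<pi> permutes {..<n} \<and> M = mat n n (\<lambda>(i, j). if i = \<pi> j then 1 else 0))"

text \<open>\<open>toeplitz_perm_product n T P m\<close> is the product over \<open>k = 1, \<dots>, m\<close>, from left to right, of
  \<open>T (2k - 1) * T (2k) * P k\<close>.\<close>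

primrec toeplitz_perm_product ::
  "nat \<Rightarrow> (nat \<Rightarrow> complex mat) \<Rightarrow> (nat \<Rightarrow> complex mat) \<Rightarrow> nat \<Rightarrow> complex mat" where
  "toeplitz_perm_product n T P 0 = 1\<^sub>m n"
| "toeplitz_perm_product n T P (Suc k) =
     toeplitz_perm_product n T P k * T (2 * k + 1) * T (2 * k + 2) * P (k + 1)"


section \<open>The Zariski topology on n by n matrices\<close>

text \<open>Polynomials in the \<open>n\<^sup>2\<close> matrix entries, as functions: the algebra of functions generated by
  the constants and the entries.\<close>

inductive_set polynomial_maps :: "nat \<Rightarrow> (complex mat \<Rightarrow> complex) set" for n :: nat where
  const: "(\<lambda>_. c) \<in> polynomial_maps n"
| entry: "i < n \<Longrightarrow> j < n \<Longrightarrow> (\<lambda>A. A $$ (i, j)) \<in> polynomial_maps n"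
| add: "f \<in> polynomial_maps n \<Longrightarrow> g \<in> polynomial_maps n \<Longrightarrow> (\<lambda>A. f A + g A) \<in> polynomial_maps n"
| mult: "f \<in> polynomial_maps n \<Longrightarrow> g \<in> polynomial_maps n \<Longrightarrow> (\<lambda>A. f A * g A) \<in> polynomial_maps n"

definition zariski_closed :: "nat \<Rightarrow> complex mat set \<Rightarrow> bool" where
  "zariski_closed n Z \<longleftrightarrow>
     (\<exists>F \<subseteq> polynomial_maps n. Z = {A \<in> carrier_mat n n. \<forall>f\<in>F. f A = 0})"

definition zariski_closure :: "nat \<Rightarrow> complex mat set \<Rightarrow> complex mat set" where
  "zariski_closure n X = \<Inter>{Z. zariski_closed n Z \<and> X \<subseteq> Z}"

lemma zariski_closed_closure:
  assumes "X \<subseteq> carrier_mat n n"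
  shows "zariski_closed n (zariski_closure n X)"
proof -
  define F where "F = {f \<in> polynomial_maps n. \<forall>A\<in>X. f A = 0}"
  define Z where "Z = {A \<in> carrier_mat n n. \<forall>f\<in>F. f A = 0}"
  have F: "F \<subseteq> polynomial_maps n"
    by (rule subsetI) (simp add: F_def)
  have Z: "zariski_closed n Z"
    unfolding zariski_closed_def using F Z_def by (intro exI[of _ F] conjI)
  have XZ: "X \<subseteq> Z"
  proof
    fix A assume "A \<in> X"
    with assms show "A \<in> Z" by (simp add: Z_def F_def subset_iff)
  qed
  have "zariski_closure n X = Z"
  proof (rule subset_antisym)
    show "zariski_closure n X \<subseteq> Z"
      unfolding zariski_closure_def by (rule Inter_lower) (simp add: Z XZ)
    show "Z \<subseteq> zariski_closure n X"
      unfolding zariski_closure_def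
    proof (rule Inter_greatest)
      fix Y assume "Y \<in> {Y. zariski_closed n Y \<and> X \<subseteq> Y}"
      then have XY: "X \<subseteq> Y"
        and "\<exists>G \<subseteq> polynomial_maps n. Y = {A \<in> carrier_mat n n. \<forall>f\<in>G. f A = 0}"
        by (simp_all add: zariski_closed_def)
      then obtain G where G: "G \<subseteq> polynomial_maps n"
        and Y: "Y = {A \<in> carrier_mat n n. \<forall>f\<in>G. f A = 0}"
        by (elim exE conjE)
      have "G \<subseteq> F"
      proof
        fix f assume f: "f \<in> G"
        then have "f A = 0" if "A \<in> X" for A
          using that XY by (simp add: Y subset_iff)
        with f G show "f \<in> F" by (simp add: F_def subset_iff)
      qed
      then show "Z \<subseteq> Y"
        by (simp add: Z_def Y subset_iff)
    qed
  qed
  with Z show ?thesis by simp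
qed

definition holds_generically :: "nat \<Rightarrow> (complex mat \<Rightarrow> bool) \<Rightarrow> bool" where
  "holds_generically n Q \<longleftrightarrow>
     zariski_closure n {A \<in> carrier_mat n n. \<not> Q A} \<subset> carrier_mat n n"


section \<open>Algorithms in exact complex arithmetic\<close>

text \<open>
  An algorithm is a while program, one and the same for all dimensions. It has index variables
  holding natural numbers, used for loop control and addressing, and multi-dimensional arrays of
  complex numbers. Complex numbers can only be copied, combined by the four arithmetic operations
  (the constants 0 and 1 being available), and tested for being zero; they cannot be converted to
  or from indices. Only arithmetic operations on complex numbers are counted. A division by zero
  has no result: the program is then stuck and has no terminating execution.
\<close>

datatype iexp = IConst nat | IVar string | IAdd iexp iexp | ISub iexp iexp | IMul iexp iexp

type_synonym cell = "string \<times> iexp list"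

datatype arith_op = Add | Sub | Mul | Div

datatype cexp = Zero | One | Read cell | Arith arith_op cexp cexp

datatype bexp = ILess iexp iexp | IsZero cell | BNot bexp | BAnd bexp bexp

datatype program =
    Skip
  | SetIndex string iexp
  | Assign cell cexp
  | Seq program program
  | Cond bexp program program
  | While bexp program

type_synonym index_store = "string \<Rightarrow> nat"
type_synonym complex_store = "string \<Rightarrow> nat list \<Rightarrow> complex"
type_synonym state = "index_store \<times> complex_store"

primrec ival :: "iexp \<Rightarrow> index_store \<Rightarrow> nat" where
  "ival (IConst k) v = k"
| "ival (IVar x) v = v x"
| "ival (IAdd a b) v = ival a v + ival b v"
| "ival (ISub a b) v = ival a v - ival b v"
| "ival (IMul a b) v = ival a v * ival b v"

definition address :: "cell \<Rightarrow> index_store \<Rightarrow> nat list" where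
  "address l v = map (\<lambda>a. ival a v) (snd l)"

definition read_cell :: "cell \<Rightarrow> state \<Rightarrow> complex" where
  "read_cell l s = snd s (fst l) (address l (fst s))"

definition write_cell :: "cell \<Rightarrow> complex \<Rightarrow> state \<Rightarrow> state" where
  "write_cell l z s =
     (fst s, (snd s)(fst l := (snd s (fst l))(address l (fst s) := z)))"

primrec arith :: "arith_op \<Rightarrow> complex \<Rightarrow> complex \<Rightarrow> complex option" where
  "arith Add x y = Some (x + y)"
| "arith Sub x y = Some (x - y)"
| "arith Mul x y = Some (x * y)"
| "arith Div x y = (if y = 0 then None else Some (x / y))"

primrec cval :: "cexp \<Rightarrow> state \<Rightarrow> complex option" where
  "cval Zero s = Some 0"
| "cval One s = Some 1"
| "cval (Read l) s = Some (read_cell l s)"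
| "cval (Arith f a b) s =
     Option.bind (cval a s) (\<lambda>x. Option.bind (cval b s) (\<lambda>y. arith f x y))"

primrec arith_ops :: "cexp \<Rightarrow> nat" where
  "arith_ops Zero = 0"
| "arith_ops One = 0"
| "arith_ops (Read l) = 0"
| "arith_ops (Arith f a b) = arith_ops a + arith_ops b + 1"

primrec bval :: "bexp \<Rightarrow> state \<Rightarrow> bool" where
  "bval (ILess a b) s \<longleftrightarrow> ival a (fst s) < ival b (fst s)"
| "bval (IsZero l) s \<longleftrightarrow> read_cell l s = 0"
| "bval (BNot b) s \<longleftrightarrow> \<not> bval b s"
| "bval (BAnd b c) s \<longleftrightarrow> bval b s \<and> bval c s"

text \<open>\<open>exec p s t s'\<close>: started in state \<open>s\<close>, the program \<open>p\<close> terminates in state \<open>s'\<close> after performing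
  exactly \<open>t\<close> arithmetic operations on complex numbers.\<close>

inductive exec :: "program \<Rightarrow> state \<Rightarrow> nat \<Rightarrow> state \<Rightarrow> bool" where
  skip: "exec Skip s 0 s"
| set_index: "exec (SetIndex x a) s 0 ((fst s)(x := ival a (fst s)), snd s)"
| assign: "cval e s = Some z \<Longrightarrow> exec (Assign l e) s (arith_ops e) (write_cell l z s)"
| seq: "exec p s t s' \<Longrightarrow> exec q s' u s'' \<Longrightarrow> exec (Seq p q) s (t + u) s''"
| cond_true: "bval b s \<Longrightarrow> exec p s t s' \<Longrightarrow> exec (Cond b p q) s t s'"
| cond_false: "\<not> bval b s \<Longrightarrow> exec q s t s' \<Longrightarrow> exec (Cond b p q) s t s'"
| while_false: "\<not> bval b s \<Longrightarrow> exec (While b p) s 0 s"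
| while_true: "bval b s \<Longrightarrow> exec p s t s' \<Longrightarrow> exec (While b p) s' u s'' \<Longrightarrow>
    exec (While b p) s (t + u) s''"

inductive_cases skipE: "exec Skip s t s'"
inductive_cases set_indexE: "exec (SetIndex x a) s t s'"
inductive_cases assignE: "exec (Assign l e) s t s'"
inductive_cases seqE: "exec (Seq p q) s t s'"
inductive_cases condE: "exec (Cond b p q) s t s'"
inductive_cases whileE: "exec (While b p) s t s'"

lemma exec_deterministic:
  "exec p s t s' \<Longrightarrow> exec p s u r \<Longrightarrow> t = u \<and> s' = r"
proof (induction arbitrary: u r rule: exec.induct)
  case (skip s)
  then show ?case by (rule skipE) simp
next
  case (set_index x a s)
  then show ?case by (rule set_indexE) simp
next
  case (assign e s z l)
  from assign.prems show ?case by (rule assignE) (use assign.hyps in simp)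
next
  case (seq p s t s' q v s'')
  from seq.prems show ?case
  proof (rule seqE)
    fix t1 s1 v1
    assume u: "u = t1 + v1" and p: "exec p s t1 s1" and q: "exec q s1 v1 r"
    from seq.IH(1)[OF p] have *: "t = t1" "s' = s1" by simp_all
    from seq.IH(2)[unfolded *, OF q] * u show ?thesis by simp
  qed
next
  case (cond_true b s p t s' q)
  from cond_true.prems show ?case
  proof (rule condE)
    assume "\<not> bval b s"
    then show ?thesis using cond_true.hyps(1) by (rule notE)
  qed (rule cond_true.IH)
next
  case (cond_false b s q t s' p)
  from cond_false.prems show ?case
  proof (rule condE)
    assume "bval b s"
    with cond_false.hyps(1) show ?thesis by (rule notE)
  qed (rule cond_false.IH)
next
  case (while_false b s p)
  from while_false.prems show ?case by (rule whileE) (use while_false.hyps in simp_all)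
next
  case (while_true b s p t s' v s'')
  from while_true.prems show ?case
  proof (rule whileE)
    assume "\<not> bval b s"
    then show ?thesis using while_true.hyps(1) by (rule notE)
  next
    fix t1 s1 v1
    assume u: "u = t1 + v1" and p: "exec p s t1 s1" and q: "exec (While b p) s1 v1 r"
    from while_true.IH(1)[OF p] have *: "t = t1" "s' = s1" by simp_all
    from while_true.IH(2)[unfolded *, OF q] * u show ?thesis by simp
  qed
qed

text \<open>The input is the dimension, in the index variable \<open>n\<close>, and the matrix, in the array \<open>A\<close>.
  All other variables and array cells are 0.\<close>

definition input_state :: "nat \<Rightarrow> complex mat \<Rightarrow> state" where
  "input_state n A =
     ((\<lambda>_. 0)(''n'' := n),
      (\<lambda>_ _. 0)(''A'' := (\<lambda>is. case is of
         [i, j] \<Rightarrow> if i < n \<and> j < n then A $$ (i, j) else 0 | _ \<Rightarrow> 0)))"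

text \<open>Output matrices are stored entry by entry: entry \<open>(i, j)\<close> of the \<open>k\<close>-th matrix of the family \<open>X\<close>
  is in cell \<open>[k, i, j]\<close> of the array \<open>X\<close>.\<close>

definition output_mat :: "nat \<Rightarrow> state \<Rightarrow> string \<Rightarrow> nat \<Rightarrow> complex mat" where
  "output_mat n s X k = mat n n (\<lambda>(i, j). snd s X [k, i, j])"

end

theory Submission
  imports Defs
begin

text \<open>Gauss-Jordan elimination writes a generic matrix as a product of \<open>n\<close> matrices that differ from the
identity in one column only. If the columns are treated from the last to the first, and the rows are
rotated by the cyclic permutation matrix \<open>C\<close> after each step, then the exceptional column is always
the last one, and elimination reads \<open>A = E(w\<^sub>0) C E(w\<^sub>1) C \<cdots> E(w\<^sub>n\<^sub>-\<^sub>1) C\<close>, where \<open>E(w)\<close> is the identity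
with last column \<open>w\<close>: a factorization of \<open>A\<close> into \<open>n\<close> companion matrices.

Each \<open>E(w)\<close> is a product of two Toeplitz matrices. Put \<open>c = w - e\<^sub>n\<close> and let \<open>L\<close> be the lower triangular
Toeplitz matrix with first column \<open>c\<close>. If \<open>c\<close> starts with a nonzero entry, then \<open>L\<close> has a lower
triangular Toeplitz inverse, and adding 1 to the upper right corner of that inverse keeps it Toeplitz.
As the corner matrix is \<open>e\<^sub>1 e\<^sub>n\<^sup>T\<close>, the product is \<open>L (L\<^sup>-\<^sup>1 + e\<^sub>1 e\<^sub>n\<^sup>T) = 1 + c e\<^sub>n\<^sup>T = E(w)\<close>
(\<open>lower_toeplitz_product\<close>). Hence \<open>P\<^sub>k = C\<close> for all \<open>k\<close>, and the factorization exists as soon as, in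
each of the \<open>n\<close> steps, the pivot and the first entry of \<open>c\<close> are nonzero
(\<open>toeplitz_perm_product_elim\<close>).

Clearing denominators turns these conditions into the nonvanishing of one polynomial in the entries of
\<open>A\<close> (\<open>elim_rational\<close>), and the \<open>n\<close>-th power of a companion matrix shows that it is not the zero
polynomial (\<open>eliminable_companion_power\<close>).

An elimination step and the inversion of a triangular Toeplitz matrix take \<open>O(n\<^sup>2)\<close> operations each, so
the \<open>n\<close> steps take \<open>O(n\<^sup>3)\<close>. The program stores every intermediate quantity in a cell of its own, which
is never overwritten by a different value. Its correctness can therefore be stated relative to one fixed final store: executing a piece of code enlarges the set of
cells that carry their final value (\<open>computes\<close>, \<open>computes_factor\<close>).\<close>

section \<open>Factoring by Gauss-Jordan elimination\<close>

text \<open>The coefficients of the reciprocal of the power series with coefficients \<open>c\<close>, that is, the first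
column of the inverse of the lower triangular Toeplitz matrix with first column \<open>c\<close>.\<close>

fun reciprocal_coeff :: "(nat \<Rightarrow> complex) \<Rightarrow> nat \<Rightarrow> complex" where
  "reciprocal_coeff c m =
     ((if m = 0 then 1 else 0) - (\<Sum>l<m. c (m - l) * reciprocal_coeff c l)) / c 0"

declare reciprocal_coeff.simps [simp del]

lemma reciprocal_convolution:
  assumes "c 0 \<noteq> 0"
  shows "(\<Sum>l\<le>m. c (m - l) * reciprocal_coeff c l) = (if m = 0 then 1 else 0)"
proof -
  have "(\<Sum>l\<le>m. c (m - l) * reciprocal_coeff c l) =
      (\<Sum>l<m. c (m - l) * reciprocal_coeff c l) + c 0 * reciprocal_coeff c m"
    by (simp flip: lessThan_Suc_atMost)
  also have "c 0 * reciprocal_coeff c m =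
      (if m = 0 then 1 else 0) - (\<Sum>l<m. c (m - l) * reciprocal_coeff c l)"
    using assms by (subst reciprocal_coeff.simps) simp
  finally show ?thesis by simp
qed

definition lower_toeplitz :: "nat \<Rightarrow> (nat \<Rightarrow> complex) \<Rightarrow> complex mat" where
  "lower_toeplitz n c = mat n n (\<lambda>(i, j). if j \<le> i then c (i - j) else 0)"

definition corner_mat :: "nat \<Rightarrow> complex mat" where
  "corner_mat n = mat n n (\<lambda>(i, j). if i = 0 \<and> j = n - 1 then 1 else 0)"

definition cyclic_mat :: "nat \<Rightarrow> complex mat" where
  "cyclic_mat n = mat n n (\<lambda>(i, j). if j = Suc i \<or> i = n - 1 \<and> j = 0 then 1 else 0)"

text \<open>The second summand on the right arises because the corner matrix copies the first column of the left
factor, which is \<open>c\<close>, into the last column.\<close>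

lemma lower_toeplitz_product:
  assumes c0: "c 0 \<noteq> 0" and i: "i < n" and j: "j < n"
  shows "(lower_toeplitz n c * (lower_toeplitz n (reciprocal_coeff c) + corner_mat n)) $$ (i, j)
    = (if i = j then 1 else 0) + (if j = n - 1 then c i else 0)"
proof -
  let ?d = "reciprocal_coeff c"
  let ?C = "\<lambda>l. if l \<le> i then c (i - l) else 0"
  let ?D = "\<lambda>l. if j \<le> l then ?d (l - j) else 0"
  let ?E = "\<lambda>l. if l = 0 \<and> j = n - 1 then 1 else (0::complex)"
  have "(lower_toeplitz n c * (lower_toeplitz n ?d + corner_mat n)) $$ (i, j)
      = (\<Sum>l<n. ?C l * (?D l + ?E l))"
    using i j by (simp add: lower_toeplitz_def corner_mat_def scalar_prod_def lessThan_atLeast0)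
  also have "\<dots> = (\<Sum>l<n. ?C l * ?D l) + (\<Sum>l<n. ?C l * ?E l)"
    by (simp add: algebra_simps sum.distrib)
  also have "(\<Sum>l<n. ?C l * ?E l) = (\<Sum>l<n. if l = 0 then (if j = n - 1 then c i else 0) else 0)"
    by (intro sum.cong) auto
  also have "\<dots> = (if j = n - 1 then c i else 0)"
    using i by (subst sum.delta) auto
  also have "(\<Sum>l<n. ?C l * ?D l) = (\<Sum>l\<in>{j..i}. c (i - l) * ?d (l - j))"
    using i by (intro sum.mono_neutral_cong_right) auto
  also have "\<dots> = (if i = j then 1 else 0)"
  proof (cases "j \<le> i")
    case True
    have "(\<Sum>l\<in>{j..i}. c (i - l) * ?d (l - j)) = (\<Sum>l\<le>i - j. c (i - j - l) * ?d l)"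
      using True
      by (intro sum.reindex_bij_witness[where i = "\<lambda>l. l + j" and j = "\<lambda>l. l - j"]) auto
    also have "\<dots> = (if i - j = 0 then 1 else 0)"
      by (rule reciprocal_convolution[of c, OF c0])
    finally show ?thesis using True by simp
  qed auto
  finally show ?thesis .
qed

lemma toeplitz_lower_toeplitz: "toeplitz_mat n (lower_toeplitz n c)"
  unfolding toeplitz_mat_def lower_toeplitz_def
proof (intro conjI allI impI)
  fix i j k l assume *: "i < n" "j < n" "k < n" "l < n" "int j - int i = int l - int k"
  then have "i - j = k - l" "j \<le> i \<longleftrightarrow> l \<le> k" by linarith+
  with * show "mat n n (\<lambda>(i, j). if j \<le> i then c (i - j) else 0) $$ (i, j) =
      mat n n (\<lambda>(i, j). if j \<le> i then c (i - j) else 0) $$ (k, l)" by simp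
qed simp

lemma toeplitz_corner_mat: "toeplitz_mat n (corner_mat n)"
  unfolding toeplitz_mat_def corner_mat_def
proof (intro conjI allI impI)
  fix i j k l assume *: "i < n" "j < n" "k < n" "l < n" "int j - int i = int l - int k"
  then have "i = 0 \<and> j = n - 1 \<longleftrightarrow> k = 0 \<and> l = n - 1" by linarith
  with * show "mat n n (\<lambda>(i, j). if i = 0 \<and> j = n - 1 then 1 else 0) $$ (i, j) =
      (mat n n (\<lambda>(i, j). if i = 0 \<and> j = n - 1 then 1 else 0) $$ (k, l) :: complex)" by simp
qed simp

lemma toeplitz_add:
  assumes "toeplitz_mat n M" and "toeplitz_mat n N"
  shows "toeplitz_mat n (M + N)"
proof -
  have M: "M \<in> carrier_mat n n" and N: "N \<in> carrier_mat n n"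
    using assms by (simp_all add: toeplitz_mat_def)
  note MD = assms(1)[unfolded toeplitz_mat_def, THEN conjunct2, rule_format]
    and ND = assms(2)[unfolded toeplitz_mat_def, THEN conjunct2, rule_format]
  show ?thesis
    unfolding toeplitz_mat_def
  proof (intro conjI allI impI)
    show "M + N \<in> carrier_mat n n" using M N by simp
    fix i j k l assume *: "i < n" "j < n" "k < n" "l < n" "int j - int i = int l - int k"
    show "(M + N) $$ (i, j) = (M + N) $$ (k, l)"
      using M N * MD[OF *] ND[OF *] by simp
  qed
qed

lemma permutation_cyclic_mat: "permutation_mat n (cyclic_mat n)"
proof -
  define p where "p j = (if j < n then (if j = 0 then n - 1 else j - 1) else j)" for j
  have "bij_betw p {..<n} {..<n}"
    by (rule bij_betw_byWitness[where f' = "\<lambda>i. if i = n - 1 then 0 else Suc i"])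
       (auto simp: p_def)
  then have "p permutes {..<n}"
    by (rule bij_imp_permutes) (simp add: p_def)
  moreover have "cyclic_mat n = mat n n (\<lambda>(i, j). if i = p j then 1 else 0)"
    by (rule eq_matI) (auto simp: cyclic_mat_def p_def)
  ultimately show ?thesis
    unfolding permutation_mat_def by blast
qed

lemma carrier_mats [simp]:
  "lower_toeplitz n c \<in> carrier_mat n n"
  "corner_mat n \<in> carrier_mat n n"
  "cyclic_mat n \<in> carrier_mat n n"
  by (simp_all add: lower_toeplitz_def corner_mat_def cyclic_mat_def)

lemma dim_mats [simp]:
  "dim_row (lower_toeplitz n c) = n" "dim_col (lower_toeplitz n c) = n"
  "dim_row (corner_mat n) = n" "dim_col (corner_mat n) = n"
  by (simp_all add: lower_toeplitz_def corner_mat_def)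

text \<open>The matrix \<open>B\<^sub>k = elim n A k\<close> is what remains after \<open>k\<close> steps: column \<open>n - 1 - k\<close> of \<open>B\<^sub>k\<close> is the vector
\<open>w\<^sub>k\<close>, and \<open>B\<^sub>k\<^sub>+\<^sub>1 = C\<^sup>-\<^sup>1 E(w\<^sub>k)\<^sup>-\<^sup>1 B\<^sub>k\<close>. The inverse of \<open>C\<close> moves the pivot row, which is the last one, to
the top and every other row down by one.\<close>

primrec elim :: "nat \<Rightarrow> complex mat \<Rightarrow> nat \<Rightarrow> nat \<Rightarrow> nat \<Rightarrow> complex" where
  "elim n A 0 = (\<lambda>i j. A $$ (i, j))"
| "elim n A (Suc k) = (\<lambda>i j.
     let q = elim n A k (n - 1) j / elim n A k (n - 1) (n - 1 - k)
     in case i of 0 \<Rightarrow> q | Suc i' \<Rightarrow> elim n A k i' j - elim n A k i' (n - 1 - k) * q)"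

lemma elim_Suc_0:
  "elim n A (Suc k) 0 j = elim n A k (n - 1) j / elim n A k (n - 1) (n - 1 - k)"
  by simp

lemma elim_Suc_Suc:
  "elim n A (Suc k) (Suc i) j =
     elim n A k i j - elim n A k i (n - 1 - k) * elim n A (Suc k) 0 j"
  by (simp add: Let_def)

declare elim.simps(2) [simp del]

text \<open>The vector \<open>c = w\<^sub>k - e\<^sub>n\<close>, whose lower triangular Toeplitz matrix is the first factor in step \<open>k\<close>.\<close>

definition shifted_col :: "nat \<Rightarrow> complex mat \<Rightarrow> nat \<Rightarrow> nat \<Rightarrow> complex" where
  "shifted_col n A k i = elim n A k i (n - 1 - k) - (if i = n - 1 then 1 else 0)"

definition eliminable :: "nat \<Rightarrow> nat \<Rightarrow> complex mat \<Rightarrow> bool" where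
  "eliminable n m A \<longleftrightarrow>
     (\<forall>k<m. elim n A k (n - 1) (n - 1 - k) \<noteq> 0 \<and> shifted_col n A k 0 \<noteq> 0)"

lemma eliminable_Suc:
  "eliminable n (Suc m) A \<longleftrightarrow> eliminable n m A \<and>
     elim n A m (n - 1) (n - 1 - m) \<noteq> 0 \<and> shifted_col n A m 0 \<noteq> 0"
  unfolding eliminable_def All_less_Suc by blast

text \<open>A step turns the pivot column into the first unit vector. A column that is already a unit vector
\<open>e\<^sub>m\<close> has a zero in the pivot row, so the step only rotates it to the next unit vector. After \<open>n\<close> steps
the columns are therefore the unit vectors in their natural order.\<close>

lemma elim_unit_columns:
  assumes "eliminable n n A" and "k \<le> n" and "m < k" and "i < n"
  shows "elim n A k i (n - k + m) = (if i = m then 1 else 0)"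
  using assms(2-4)
proof (induction k arbitrary: m i)
  case (Suc k)
  have pivot: "elim n A k (n - 1) (n - 1 - k) \<noteq> 0"
    using assms(1) Suc.prems by (simp add: eliminable_def)
  show ?case
  proof (cases m)
    case 0
    have col: "n - Suc k + m = n - 1 - k" using 0 by simp
    show ?thesis
      unfolding col using pivot 0 by (cases i) (simp_all add: elim_Suc_0 elim_Suc_Suc)
  next
    case (Suc m')
    have col: "n - Suc k + m = n - k + m'" using Suc Suc.prems by simp
    have *: "elim n A k i' (n - k + m') = (if i' = m' then 1 else 0)" if "i' < n" for i'
      using Suc.IH[of m' i'] Suc Suc.prems that by simp
    have last: "elim n A k (n - 1) (n - k + m') = 0"
      using *[of "n - 1"] Suc Suc.prems by auto
    have q: "elim n A (Suc k) 0 (n - k + m') = 0"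
      unfolding elim_Suc_0 last by simp
    show ?thesis
    proof (cases i)
      case 0
      with q Suc show ?thesis unfolding col by simp
    next
      case (Suc i')
      then have "i' < n" using Suc.prems by simp
      then show ?thesis
        unfolding col unfolding Suc \<open>m = Suc m'\<close> elim_Suc_Suc q by (simp only: *) simp
    qed
  qed
qed simp

definition elim_mat :: "nat \<Rightarrow> complex mat \<Rightarrow> nat \<Rightarrow> complex mat" where
  "elim_mat n A k = mat n n (\<lambda>(i, j). elim n A k i j)"

lemma elim_mat_carrier [simp]: "elim_mat n A k \<in> carrier_mat n n"
  by (simp add: elim_mat_def)

lemma elim_mat_final:
  assumes "eliminable n n A"
  shows "elim_mat n A n = 1\<^sub>m n"
  using elim_unit_columns[OF assms order_refl] by (intro eq_matI) (auto simp: elim_mat_def)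

lemma times_mat_entry:
  assumes "M \<in> carrier_mat n n" and "N \<in> carrier_mat n n" and "i < n" and "j < n"
  shows "(M * N) $$ (i, j) = (\<Sum>l<n. M $$ (i, l) * N $$ (l, j))"
  using assms by (simp add: scalar_prod_def lessThan_atLeast0)

lemma cyclic_mat_times:
  assumes "M \<in> carrier_mat n n" and "i < n" and "j < n"
  shows "(cyclic_mat n * M) $$ (i, j) = M $$ (if i = n - 1 then 0 else Suc i, j)"
proof -
  let ?r = "if i = n - 1 then 0 else Suc i"
  have "(cyclic_mat n * M) $$ (i, j) =
      (\<Sum>l<n. (if l = Suc i \<or> i = n - 1 \<and> l = 0 then 1 else 0) * M $$ (l, j))"
    using assms by (simp add: cyclic_mat_def scalar_prod_def lessThan_atLeast0 carrier_matD)
  also have "\<dots> = (\<Sum>l<n. if l = ?r then M $$ (l, j) else 0)"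
    using assms(2) by (intro sum.cong) auto
  also have "\<dots> = M $$ (?r, j)"
    using assms(2) by (subst sum.delta) auto
  finally show ?thesis .
qed

lemma elim_mat_step:
  assumes A: "eliminable n n A" and k: "k < n"
  defines "c \<equiv> shifted_col n A k"
  shows "elim_mat n A k =
    lower_toeplitz n c * (lower_toeplitz n (reciprocal_coeff c) + corner_mat n)
      * cyclic_mat n * elim_mat n A (Suc k)" (is "_ = ?E * _ * _")
proof (rule eq_matI)
  have car: "?E \<in> carrier_mat n n" "cyclic_mat n \<in> carrier_mat n n"
    "elim_mat n A (Suc k) \<in> carrier_mat n n"
    by (auto intro!: mult_carrier_mat[of _ n n] add_carrier_mat)
  have c0: "c 0 \<noteq> 0" and pivot: "elim n A k (n - 1) (n - 1 - k) \<noteq> 0"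
    using A k by (simp_all add: eliminable_def c_def)
  let ?X = "cyclic_mat n * elim_mat n A (Suc k)"
  fix i j assume "i < dim_row (?E * cyclic_mat n * elim_mat n A (Suc k))"
    and "j < dim_col (?E * cyclic_mat n * elim_mat n A (Suc k))"
  then have i: "i < n" and j: "j < n" using car by auto
  have X: "?X $$ (l, j) = elim n A (Suc k) (if l = n - 1 then 0 else Suc l) j" if "l < n" for l
    using that j by (subst cyclic_mat_times[OF car(3)]) (auto simp: elim_mat_def)
  have "(?E * cyclic_mat n * elim_mat n A (Suc k)) $$ (i, j) = (?E * ?X) $$ (i, j)"
    by (simp only: assoc_mult_mat[OF car])
  also have "\<dots> = (\<Sum>l<n. ?E $$ (i, l) * ?X $$ (l, j))"
    by (rule times_mat_entry[OF car(1) mult_carrier_mat[OF car(2,3)] i j])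
  also have "\<dots> = (\<Sum>l<n. (if l = i then ?X $$ (l, j) else 0)
      + (if l = n - 1 then c i * ?X $$ (l, j) else 0))"
    using i by (intro sum.cong refl)
      (subst lower_toeplitz_product[of c, OF c0], auto simp: algebra_simps)
  also have "\<dots> = ?X $$ (i, j) + c i * ?X $$ (n - 1, j)"
    using i by (simp add: sum.distrib)
  also have "\<dots> = elim n A k i j"
  proof -
    define q where "q = elim n A (Suc k) 0 j"
    have q: "elim n A k (n - 1) j = q * elim n A k (n - 1) (n - 1 - k)"
      unfolding q_def elim_Suc_0 using pivot by simp
    have last: "?X $$ (n - 1, j) = q"
      using X[of "n - 1"] i by (simp add: q_def)
    show ?thesis
    proof (cases "i = n - 1")
      case True
      show ?thesis
        unfolding True last unfolding q by (simp add: c_def shifted_col_def algebra_simps)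
    next
      case False
      then show ?thesis
        unfolding X[OF i] last by (simp add: elim_Suc_Suc q_def c_def shifted_col_def)
    qed
  qed
  finally show "elim_mat n A k $$ (i, j) =
      (?E * cyclic_mat n * elim_mat n A (Suc k)) $$ (i, j)"
    using i j by (simp add: elim_mat_def)
qed (simp_all add: elim_mat_def lower_toeplitz_def)

lemma toeplitz_perm_product_elim:
  assumes A: "A \<in> carrier_mat n n" "eliminable n n A" and "m \<le> n"
    and T1: "\<And>k. k < n \<Longrightarrow> T (2 * k + 1) = lower_toeplitz n (shifted_col n A k)"
    and T2: "\<And>k. k < n \<Longrightarrow> T (2 * k + 2) =
      lower_toeplitz n (reciprocal_coeff (shifted_col n A k)) + corner_mat n"
    and P: "\<And>k. k < n \<Longrightarrow> P (k + 1) = cyclic_mat n"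
  shows "toeplitz_perm_product n T P m \<in> carrier_mat n n \<and>
    A = toeplitz_perm_product n T P m * elim_mat n A m"
  using \<open>m \<le> n\<close>
proof (induction m)
  case 0
  have "elim_mat n A 0 = A"
    using A(1) by (intro eq_matI) (auto simp: elim_mat_def)
  then show ?case using A(1) by simp
next
  case (Suc m)
  let ?Q = "toeplitz_perm_product n T P m"
  have m: "m < n" using Suc.prems by simp
  have Q: "?Q \<in> carrier_mat n n" and AQ: "A = ?Q * elim_mat n A m"
    using Suc by auto
  have car: "T (2 * m + 1) \<in> carrier_mat n n" "T (2 * m + 2) \<in> carrier_mat n n"
      "P (m + 1) \<in> carrier_mat n n" "elim_mat n A (Suc m) \<in> carrier_mat n n"
    unfolding T1[OF m] T2[OF m] P[OF m] by (auto intro!: add_carrier_mat)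
  note AQ
  also have "elim_mat n A m =
      T (2 * m + 1) * T (2 * m + 2) * P (m + 1) * elim_mat n A (Suc m)"
    unfolding T1[OF m] T2[OF m] P[OF m] by (rule elim_mat_step[OF A(2) m])
  also have "?Q * (T (2 * m + 1) * T (2 * m + 2) * P (m + 1) * elim_mat n A (Suc m)) =
      toeplitz_perm_product n T P (Suc m) * elim_mat n A (Suc m)"
    using Q car by (simp add: assoc_mult_mat[of _ n n _ n _ n] mult_carrier_mat[of _ n n])
  finally have "A = toeplitz_perm_product n T P (Suc m) * elim_mat n A (Suc m)" .
  moreover have "toeplitz_perm_product n T P (Suc m) \<in> carrier_mat n n"
    using Q car by (simp add: mult_carrier_mat[of _ n n])
  ultimately show ?case by (rule conjI[rotated])
qed


section \<open>Generic matrices can be eliminated\<close>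

lemma holds_genericallyI:
  assumes f: "f \<in> polynomial_maps n"
    and Q: "\<And>A. A \<in> carrier_mat n n \<Longrightarrow> f A \<noteq> 0 \<Longrightarrow> Q A"
    and A: "A \<in> carrier_mat n n" "f A \<noteq> 0"
  shows "holds_generically n Q"
proof -
  define Z where "Z = {A \<in> carrier_mat n n. \<forall>g\<in>{f}. g A = 0}"
  have "zariski_closed n Z"
    unfolding zariski_closed_def Z_def using f by (intro exI[of _ "{f}"]) simp
  moreover have "{A \<in> carrier_mat n n. \<not> Q A} \<subseteq> Z"
    using Q by (auto simp: Z_def)
  ultimately have "zariski_closure n {A \<in> carrier_mat n n. \<not> Q A} \<subseteq> Z"
    unfolding zariski_closure_def by (intro Inter_lower) simp
  moreover have "Z \<subset> carrier_mat n n"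
    using A by (auto simp: Z_def)
  ultimately show ?thesis
    unfolding holds_generically_def by (rule subset_psubset_trans)
qed

lemma polynomial_maps_diff:
  assumes "f \<in> polynomial_maps n" and "g \<in> polynomial_maps n"
  shows "(\<lambda>A. f A - g A) \<in> polynomial_maps n"
  using polynomial_maps.add[OF assms(1)
      polynomial_maps.mult[OF polynomial_maps.const[of "-1"] assms(2)]] by simp

text \<open>If \<open>B\<^sub>m = N / D\<close> with pivot numerator \<open>w\<close>, then all denominators of \<open>B\<^sub>m\<^sub>+\<^sub>1\<close> divide \<open>D w\<close>. Multiplying the
new denominator by \<open>u\<close> as well, the numerator of the first entry of the shifted column, makes its
nonvanishing equivalent to the success of all steps so far.\<close>

lemma elim_rational:
  assumes "m \<le> n"
  shows "\<exists>D N. D \<in> polynomial_maps n \<and>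
    (\<forall>i<n. \<forall>j<n. N i j \<in> polynomial_maps n) \<and>
    (\<forall>A. (D A \<noteq> 0 \<longleftrightarrow> eliminable n m A) \<and>
      (D A \<noteq> 0 \<longrightarrow> (\<forall>i<n. \<forall>j<n. elim n A m i j = N i j A / D A)))"
  using assms
proof (induction m)
  case 0
  show ?case
    by (rule exI[of _ "\<lambda>_. 1"], rule exI[of _ "\<lambda>i j A. A $$ (i, j)"])
       (auto simp: eliminable_def intro: polynomial_maps.intros)
next
  case (Suc m)
  from Suc.IH[OF Suc_leD[OF Suc.prems]] obtain D N where D: "D \<in> polynomial_maps n"
    and N': "\<forall>i<n. \<forall>j<n. N i j \<in> polynomial_maps n"
    and DN: "\<forall>A. (D A \<noteq> 0 \<longleftrightarrow> eliminable n m A) \<and>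
      (D A \<noteq> 0 \<longrightarrow> (\<forall>i<n. \<forall>j<n. elim n A m i j = N i j A / D A))"
    by (elim exE conjE)
  have N: "N i j \<in> polynomial_maps n" if "i < n" "j < n" for i j
    using N' that by simp
  have D0: "D A \<noteq> 0 \<longleftrightarrow> eliminable n m A" for A
    by (rule conjunct1[OF spec[OF DN]])
  have eq: "elim n A m i j = N i j A / D A" if "D A \<noteq> 0" "i < n" "j < n" for A i j
    using conjunct2[OF spec[OF DN]] that by blast
  let ?j = "n - 1 - m"
  have n: "n - 1 < n" "?j < n" "0 < n" using Suc.prems by auto
  define w where "w = N (n - 1) ?j"
  define u where "u A = N 0 ?j A - (if n = 1 then 1 else 0) * D A" for A
  define D' where "D' A = D A * (w A * u A)" for A
  define N' where "N' i j = (\<lambda>A. (case i of 0 \<Rightarrow> D A * N (n - 1) j A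
    | Suc i' \<Rightarrow> N i' j A * w A - N i' ?j A * N (n - 1) j A) * u A)" for i j
  have w: "w \<in> polynomial_maps n" unfolding w_def by (intro N n)
  have u: "u \<in> polynomial_maps n" unfolding u_def
    by (intro polynomial_maps_diff polynomial_maps.intros N D n)
  have D': "D' \<in> polynomial_maps n" unfolding D'_def
    by (intro polynomial_maps.mult D w u)
  have N': "N' i j \<in> polynomial_maps n" if "i < n" "j < n" for i j
  proof (cases i)
    case 0
    show ?thesis unfolding N'_def 0 nat.case
      by (intro polynomial_maps.mult D u N n that)
  next
    case (Suc i')
    then have "i' < n" using that by simp
    then show ?thesis unfolding N'_def Suc nat.case
      by (intro polynomial_maps.mult polynomial_maps_diff u w N n that)
  qed
  have "(D' A \<noteq> 0 \<longleftrightarrow> eliminable n (Suc m) A) \<and>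
      (D' A \<noteq> 0 \<longrightarrow> (\<forall>i<n. \<forall>j<n. elim n A (Suc m) i j = N' i j A / D' A))" for A
  proof (cases "D A = 0")
    case True
    then have "\<not> eliminable n m A" using D0 by blast
    then have "\<not> eliminable n (Suc m) A" by (simp add: eliminable_Suc)
    with True show ?thesis by (simp add: D'_def)
  next
    case False
    have pivot: "elim n A m (n - 1) ?j = w A / D A"
      using eq[OF False n(1,2)] by (simp add: w_def)
    have "0 = n - 1 \<longleftrightarrow> n = 1" using n by auto
    then have first: "shifted_col n A m 0 = u A / D A"
      unfolding shifted_col_def u_def using eq[OF False n(3,2)] False
      by (simp add: diff_divide_distrib)
    have "eliminable n (Suc m) A \<longleftrightarrow> w A / D A \<noteq> 0 \<and> u A / D A \<noteq> 0"
      using False D0[of A] unfolding eliminable_Suc pivot first by blast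
    moreover have "elim n A (Suc m) i j = N' i j A / D' A"
      if D'A: "D' A \<noteq> 0" and "i < n" "j < n" for i j
    proof -
      have nz: "w A \<noteq> 0" "u A \<noteq> 0" using D'A by (auto simp: D'_def)
      have q: "elim n A (Suc m) 0 j = N (n - 1) j A / w A"
        using False n that by (simp only: elim_Suc_0 pivot) (simp add: eq)
      show ?thesis
      proof (cases i)
        case 0
        then show ?thesis using q False nz by (simp add: N'_def D'_def)
      next
        case (Suc i')
        then have i': "i' < n" using that by simp
        show ?thesis
          unfolding Suc elim_Suc_Suc q eq[OF False i' that(3)] eq[OF False i' n(2)]
          using False nz by (simp add: N'_def D'_def field_simps)
      qed
    qed
    ultimately show ?thesis using False by (auto simp: D'_def)
  qed
  with D' N' show ?case
    by (intro exI[of _ D'] exI[of _ N']) blast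
qed

text \<open>The powers of the matrix \<open>M = E(w) C\<close>, where all entries of \<open>w\<close> are 2: multiplication by \<open>M\<close> from the
left shifts the rows up and adds twice the old first row to all of them. In the elimination of \<open>M\<^sup>n\<close>
each step splits off one factor \<open>M\<close>. The value 2 makes both the pivot 2 and the first entry of \<open>w - e\<^sub>n\<close>
nonzero, also for \<open>n = 1\<close>, where that entry is 1.\<close>

primrec companion_power :: "nat \<Rightarrow> nat \<Rightarrow> nat \<Rightarrow> nat \<Rightarrow> complex" where
  "companion_power n 0 i j = (if i = j then 1 else 0)"
| "companion_power n (Suc m) i j =
     2 * companion_power n m 0 j + (if Suc i < n then companion_power n m (Suc i) j else 0)"

lemma companion_power_unit_column:
  assumes "m \<le> j" and "j < n"
  shows "companion_power n m i j = (if i = j - m then 1 else 0)"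
  using assms by (induction m arbitrary: i) auto

lemma companion_power_column:
  assumes "m < n"
  shows "companion_power n (Suc m) i m = 2"
  using assms by (simp add: companion_power_unit_column)

lemma elim_companion_power:
  assumes "k \<le> n" and "i < n" and "j < n"
  shows "elim n (mat n n (\<lambda>(i, j). companion_power n n i j)) k i j
    = companion_power n (n - k) i j"
  using assms
proof (induction k arbitrary: i j)
  case (Suc k)
  let ?A = "mat n n (\<lambda>(i, j). companion_power n n i j)"
  define m where "m = n - Suc k"
  have m: "n - k = Suc m" "n - 1 - k = m" "m < n" using Suc.prems by (auto simp: m_def)
  have IH: "elim n ?A k i j = companion_power n (Suc m) i j" if "i < n" "j < n" for i j
    using Suc.IH[OF _ that] Suc.prems m by simp
  have q: "elim n ?A (Suc k) 0 j = companion_power n m 0 j"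
  proof -
    have last: "n - 1 < n" using m(3) by simp
    show ?thesis
      unfolding elim_Suc_0 m(2) IH[OF last Suc.prems(3)] IH[OF last m(3)]
        companion_power_column[OF m(3)] by simp
  qed
  show ?case
  proof (cases i)
    case 0
    then show ?thesis by (simp add: q m_def)
  next
    case (Suc i')
    then have i': "i' < n" "Suc i' < n" using Suc.prems by auto
    have "elim n ?A (Suc k) i j = companion_power n (Suc m) i' j - 2 * companion_power n m 0 j"
      unfolding Suc elim_Suc_Suc q m(2) IH[OF i'(1) Suc.prems(3)] IH[OF i'(1) m(3)]
        companion_power_column[OF m(3)] ..
    with i' Suc show ?thesis by (simp add: m_def)
  qed
qed simp

lemma eliminable_companion_power:
  "eliminable n n (mat n n (\<lambda>(i, j). companion_power n n i j))"
  unfolding eliminable_def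
proof (intro allI impI)
  fix k assume k: "k < n"
  let ?A = "mat n n (\<lambda>(i, j). companion_power n n i j)"
  have "elim n ?A k i (n - 1 - k) = 2" if "i < n" for i
  proof -
    have "n - k = Suc (n - 1 - k)" using k by simp
    with k that show ?thesis
      using elim_companion_power[of k n i "n - 1 - k"] companion_power_column[of "n - 1 - k" n i]
      by simp
  qed
  with k show "elim n ?A k (n - 1) (n - 1 - k) \<noteq> 0 \<and> shifted_col n ?A k 0 \<noteq> 0"
    by (simp add: shifted_col_def)
qed

lemma generically_eliminable:
  assumes "\<And>A. A \<in> carrier_mat n n \<Longrightarrow> eliminable n n A \<Longrightarrow> Q A"
  shows "holds_generically n Q"
proof -
  obtain D where D: "D \<in> polynomial_maps n" "\<And>A. D A \<noteq> 0 \<longleftrightarrow> eliminable n n A"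
    using elim_rational[of n n] by auto
  show ?thesis
  proof (rule holds_genericallyI[OF D(1)])
    show "D (mat n n (\<lambda>(i, j). companion_power n n i j)) \<noteq> 0"
      unfolding D(2) by (rule eliminable_companion_power)
  qed (simp_all add: D(2) assms)
qed


section \<open>Reasoning about programs that write each cell once\<close>

text \<open>The store \<open>F\<close> is the intended final content of the arrays. A piece of code is specified by the cells \<open>R\<close>
that have to be final when it starts and by the further cells \<open>W\<close> that are final when it ends. Since
only final values are ever written, cells once final remain so, and no frame conditions about
untouched cells are needed; a cell whose initial value is the intended one is final from the start.\<close>

definition agrees ::
  "complex_store \<Rightarrow> (string \<times> nat list) set \<Rightarrow> complex_store \<Rightarrow> bool" where
  "agrees F R \<sigma> \<longleftrightarrow> (\<forall>(X, is)\<in>R. \<sigma> X is = F X is)"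

definition computes ::
  "complex_store \<Rightarrow> program \<Rightarrow> index_store \<Rightarrow> (string \<times> nat list) set \<Rightarrow>
    (string \<times> nat list) set \<Rightarrow> nat \<Rightarrow> bool" where
  "computes F p v R W c \<longleftrightarrow> (\<forall>\<sigma>. agrees F R \<sigma> \<longrightarrow>
     (\<exists>t \<sigma>'. exec p (v, \<sigma>) t (v, \<sigma>') \<and> t \<le> c \<and> agrees F (R \<union> W) \<sigma>'))"

lemma agreesD: "agrees F R \<sigma> \<Longrightarrow> (X, is) \<in> R \<Longrightarrow> \<sigma> X is = F X is"
  by (auto simp: agrees_def)

lemma agrees_mono: "agrees F R \<sigma> \<Longrightarrow> R' \<subseteq> R \<Longrightarrow> agrees F R' \<sigma>"
  by (auto simp: agrees_def)

lemma computes_assign: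
  assumes "map (\<lambda>a. ival a v) as = is"
    and "\<And>\<sigma>. agrees F R \<sigma> \<Longrightarrow> cval e (v, \<sigma>) = Some (F X is)"
  shows "computes F (Assign (X, as) e) v R {(X, is)} (arith_ops e)"
  unfolding computes_def
proof (intro allI impI)
  fix \<sigma> assume \<sigma>: "agrees F R \<sigma>"
  have "exec (Assign (X, as) e) (v, \<sigma>) (arith_ops e)
      (v, \<sigma>(X := (\<sigma> X)(is := F X is)))"
    using exec.assign[OF assms(2)[OF \<sigma>], of "(X, as)"] assms(1)
    by (simp add: write_cell_def address_def)
  moreover have "agrees F (R \<union> {(X, is)}) (\<sigma>(X := (\<sigma> X)(is := F X is)))"
    using \<sigma> by (auto simp: agrees_def)
  ultimately show "\<exists>t \<sigma>'. exec (Assign (X, as) e) (v, \<sigma>) t (v, \<sigma>') \<and> t \<le> arith_ops e \<and>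
      agrees F (R \<union> {(X, is)}) \<sigma>'" by blast
qed

lemma computes_seq:
  assumes "computes F p v R W c" and "computes F q v (R \<union> W) W' c'"
  shows "computes F (Seq p q) v R (W \<union> W') (c + c')"
  unfolding computes_def
proof (intro allI impI)
  fix \<sigma> assume "agrees F R \<sigma>"
  then obtain t \<sigma>' where 1: "exec p (v, \<sigma>) t (v, \<sigma>')" "t \<le> c" "agrees F (R \<union> W) \<sigma>'"
    using assms(1) unfolding computes_def by blast
  then obtain u \<sigma>'' where 2: "exec q (v, \<sigma>') u (v, \<sigma>'')" "u \<le> c'" "agrees F (R \<union> W \<union> W') \<sigma>''"
    using assms(2) unfolding computes_def by blast
  show "\<exists>t \<sigma>'. exec (Seq p q) (v, \<sigma>) t (v, \<sigma>') \<and> t \<le> c + c' \<and> agrees F (R \<union> (W \<union> W')) \<sigma>'"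
    using exec.seq[OF 1(1) 2(1)] 1(2) 2(2,3) by (metis Un_assoc add_mono)
qed

lemma computes_weaken:
  assumes "computes F p v R W c" and "W' \<subseteq> W" and "c \<le> c'"
  shows "computes F p v R W' c'"
  unfolding computes_def
proof (intro allI impI)
  fix \<sigma> assume "agrees F R \<sigma>"
  then obtain t \<sigma>' where "exec p (v, \<sigma>) t (v, \<sigma>')" "t \<le> c" "agrees F (R \<union> W) \<sigma>'"
    using assms(1) unfolding computes_def by blast
  moreover have "agrees F (R \<union> W') \<sigma>'"
    using \<open>agrees F (R \<union> W) \<sigma>'\<close> assms(2) by (auto simp: agrees_def)
  ultimately show "\<exists>t \<sigma>'. exec p (v, \<sigma>) t (v, \<sigma>') \<and> t \<le> c' \<and> agrees F (R \<union> W') \<sigma>'"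
    using assms(3) order_trans by blast
qed

text \<open>Resetting the loop variable at the end makes loops restore the index store, which is why \<open>computes\<close> can
demand the same index store before and after execution.\<close>

definition For :: "string \<Rightarrow> iexp \<Rightarrow> program \<Rightarrow> program" where
  "For x b p = Seq
     (While (ILess (IVar x) b) (Seq p (SetIndex x (IAdd (IVar x) (IConst 1)))))
     (SetIndex x (IConst 0))"

lemma computes_For:
  assumes x: "v x = 0" and b: "\<And>i. ival b (v(x := i)) = N"
    and p: "\<And>i. i < N \<Longrightarrow> computes F p (v(x := i)) (R \<union> (\<Union>j<i. W j)) (W i) c"
  shows "computes F (For x b p) v R (\<Union>i<N. W i) (N * c)"
  unfolding computes_def
proof (intro allI impI)
  fix \<sigma> assume \<sigma>: "agrees F R \<sigma>"
  let ?body = "Seq p (SetIndex x (IAdd (IVar x) (IConst 1)))"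
  let ?loop = "While (ILess (IVar x) b) ?body"
  have loop: "\<exists>t \<sigma>'. exec ?loop (v(x := i), \<sigma>) t (v(x := N), \<sigma>') \<and> t \<le> (N - i) * c \<and>
      agrees F (R \<union> (\<Union>j<N. W j)) \<sigma>'"
    if "i \<le> N" "agrees F (R \<union> (\<Union>j<i. W j)) \<sigma>" for i \<sigma>
    using that
  proof (induction i arbitrary: \<sigma> rule: inc_induct)
    case base
    show ?case
    proof (intro exI conjI)
      show "exec ?loop (v(x := N), \<sigma>) 0 (v(x := N), \<sigma>)"
        by (rule exec.while_false) (simp add: b)
    qed (use base in simp_all)
  next
    case (step i)
    obtain t \<sigma>' where 1: "exec p (v(x := i), \<sigma>) t (v(x := i), \<sigma>')" "t \<le> c"
        "agrees F (R \<union> (\<Union>j<i. W j) \<union> W i) \<sigma>'"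
      using p[OF \<open>i < N\<close>] step.prems unfolding computes_def by blast
    have "R \<union> (\<Union>j<i. W j) \<union> W i = R \<union> (\<Union>j<Suc i. W j)"
      by (auto simp: lessThan_Suc)
    with 1(3) have "agrees F (R \<union> (\<Union>j<Suc i. W j)) \<sigma>'" by simp
    from step.IH[OF this] obtain u \<sigma>'' where
      2: "exec ?loop (v(x := Suc i), \<sigma>') u (v(x := N), \<sigma>'')" "u \<le> (N - Suc i) * c"
        "agrees F (R \<union> (\<Union>j<N. W j)) \<sigma>''"
      by blast
    have "exec ?body (v(x := i), \<sigma>) (t + 0) (v(x := Suc i), \<sigma>')"
      using exec.set_index[of x "IAdd (IVar x) (IConst 1)" "(v(x := i), \<sigma>')"]
      by (intro exec.seq[OF 1(1)]) simp
    then have "exec ?loop (v(x := i), \<sigma>) (t + 0 + u) (v(x := N), \<sigma>'')"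
      using \<open>i < N\<close> 2(1) by (intro exec.while_true) (simp_all add: b)
    moreover have "t + 0 + u \<le> (N - i) * c"
    proof -
      have "N - i = Suc (N - Suc i)"
        using \<open>i < N\<close> by simp
      then have "(N - i) * c = c + (N - Suc i) * c"
        by (simp only: mult_Suc)
      with 1(2) 2(2) show ?thesis by simp
    qed
    ultimately show ?case using 2(3) by blast
  qed
  have "v(x := 0) = v" using x by (simp add: fun_upd_idem)
  with loop[of 0 \<sigma>] \<sigma> obtain t \<sigma>' where
    *: "exec ?loop (v, \<sigma>) t (v(x := N), \<sigma>')" "t \<le> N * c" "agrees F (R \<union> (\<Union>j<N. W j)) \<sigma>'"
    by auto
  have "exec (SetIndex x (IConst 0)) (v(x := N), \<sigma>') 0 (v, \<sigma>')"
    using exec.set_index[of x "IConst 0" "(v(x := N), \<sigma>')"] \<open>v(x := 0) = v\<close> by simp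
  with *(1) have "exec (For x b p) (v, \<sigma>) (t + 0) (v, \<sigma>')"
    unfolding For_def by (rule exec.seq)
  with * show "\<exists>t \<sigma>'. exec (For x b p) (v, \<sigma>) t (v, \<sigma>') \<and> t \<le> N * c \<and>
      agrees F (R \<union> (\<Union>i<N. W i)) \<sigma>'" by auto
qed


section \<open>The program\<close>

abbreviation (input) "vn \<equiv> IVar ''n''"
abbreviation (input) "vk \<equiv> IVar ''k''"
abbreviation (input) "vi \<equiv> IVar ''i''"
abbreviation (input) "vj \<equiv> IVar ''j''"
abbreviation (input) "vlast \<equiv> ISub vn (IConst 1)"
abbreviation (input) "vpivot \<equiv> ISub vlast vk"
abbreviation (input) "vsuc a \<equiv> IAdd a (IConst 1)"

text \<open>In step \<open>k\<close>, array \<open>B\<close> holds the matrix \<open>B\<^sub>k\<close>, \<open>C\<close> the shifted column, \<open>D\<close> its reciprocal coefficients,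
and \<open>S\<close> the partial sums from which these are computed. Rows of \<open>C\<close> and \<open>D\<close> start at offset \<open>n\<close>: the
cells below the offset stay 0, so that the entry \<open>(i, j)\<close> of a lower triangular Toeplitz matrix is cell
\<open>n + i - j\<close>, without a case distinction. As indices are natural numbers with truncated subtraction,
array \<open>e\<close>, which is 1 at 0 and 0 elsewhere, serves to test indices for equality.\<close>

definition load_prog :: program where
  "load_prog = Seq (Assign (''e'', [IConst 0]) One)
     (For ''i'' vn (For ''j'' vn (Assign (''B'', [IConst 0, vi, vj]) (Read (''A'', [vi, vj])))))"

definition column_prog :: program where
  "column_prog = For ''i'' vn (Assign (''C'', [vk, IAdd vn vi])
     (Arith Sub (Read (''B'', [vk, vi, vpivot])) (Read (''e'', [ISub vlast vi]))))"

definition reciprocal_prog :: program where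
  "reciprocal_prog = For ''i'' vn (Seq
     (For ''j'' vi (Assign (''S'', [vk, vi, vsuc vj])
       (Arith Add (Read (''S'', [vk, vi, vj]))
         (Arith Mul (Read (''C'', [vk, IAdd vn (ISub vi vj)])) (Read (''D'', [vk, IAdd vn vj]))))))
     (Assign (''D'', [vk, IAdd vn vi])
       (Arith Div (Arith Sub (Read (''e'', [vi])) (Read (''S'', [vk, vi, vi])))
         (Read (''C'', [vk, vn])))))"

definition block_prog :: "string \<Rightarrow> iexp \<Rightarrow> cexp \<Rightarrow> program" where
  "block_prog X a e = For ''i'' vn (For ''j'' vn (Assign (X, [a, vi, vj]) e))"

definition first_factor_prog :: program where
  "first_factor_prog = block_prog ''T'' (vsuc (IMul (IConst 2) vk))
     (Read (''C'', [vk, ISub (IAdd vn vi) vj]))"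

definition second_factor_prog :: program where
  "second_factor_prog = block_prog ''T'' (IAdd (IMul (IConst 2) vk) (IConst 2))
     (Arith Add (Read (''D'', [vk, ISub (IAdd vn vi) vj]))
       (Read (''e'', [IAdd vi (ISub vlast vj)])))"

text \<open>With truncated subtraction, \<open>(a - b) + (b - a)\<close> is the distance of \<open>a\<close> and \<open>b\<close>. The first cell read is
thus 1 for \<open>j = i + 1\<close>, and the second one for \<open>i = n - 1\<close> and \<open>j = 0\<close>.\<close>

definition permutation_prog :: program where
  "permutation_prog = block_prog ''P'' (vsuc vk)
     (Arith Add (Read (''e'', [IAdd (ISub (vsuc vi) vj) (ISub vj (vsuc vi))]))
       (Read (''e'', [IAdd (ISub vlast vi) vj])))"

definition pivot_row_prog :: program where
  "pivot_row_prog = For ''j'' vn (Assign (''B'', [vsuc vk, IConst 0, vj])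
     (Arith Div (Read (''B'', [vk, vlast, vj])) (Read (''B'', [vk, vlast, vpivot]))))"

definition other_rows_prog :: program where
  "other_rows_prog = For ''i'' vlast (For ''j'' vn (Assign (''B'', [vsuc vk, vsuc vi, vj])
     (Arith Sub (Read (''B'', [vk, vi, vj]))
       (Arith Mul (Read (''B'', [vk, vi, vpivot])) (Read (''B'', [vsuc vk, IConst 0, vj]))))))"

definition step_prog :: program where
  "step_prog = Seq column_prog (Seq reciprocal_prog (Seq first_factor_prog
     (Seq second_factor_prog (Seq permutation_prog (Seq pivot_row_prog other_rows_prog)))))"

definition factor_prog :: program where
  "factor_prog = Seq load_prog (For ''k'' vn step_prog)"


section \<open>Correctness and cost of the program\<close>

definition toeplitz_factor :: "nat \<Rightarrow> complex mat \<Rightarrow> nat \<Rightarrow> complex mat" where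
  "toeplitz_factor n A t = (let c = shifted_col n A ((t - 1) div 2) in
     if odd t then lower_toeplitz n c else lower_toeplitz n (reciprocal_coeff c) + corner_mat n)"

lemma toeplitz_factor:
  "toeplitz_factor n A (Suc (2 * k)) = lower_toeplitz n (shifted_col n A k)"
  "toeplitz_factor n A (Suc (Suc (2 * k))) =
     lower_toeplitz n (reciprocal_coeff (shifted_col n A k)) + corner_mat n"
  by (simp_all add: toeplitz_factor_def)

definition final_store :: "nat \<Rightarrow> complex mat \<Rightarrow> complex_store" where
  "final_store n A X is =
    (if X = ''A'' then (case is of [i, j] \<Rightarrow> A $$ (i, j) | _ \<Rightarrow> 0)
     else if X = ''e'' then (case is of [m] \<Rightarrow> if m = 0 then 1 else 0 | _ \<Rightarrow> 0)
     else if X = ''B'' then (case is of [k, i, j] \<Rightarrow> elim n A k i j | _ \<Rightarrow> 0)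
     else if X = ''C'' then (case is of
       [k, m] \<Rightarrow> if m < n then 0 else shifted_col n A k (m - n) | _ \<Rightarrow> 0)
     else if X = ''D'' then (case is of
       [k, m] \<Rightarrow> if m < n then 0 else reciprocal_coeff (shifted_col n A k) (m - n) | _ \<Rightarrow> 0)
     else if X = ''S'' then (case is of [k, i, j] \<Rightarrow>
       (\<Sum>l<j. shifted_col n A k (i - l) * reciprocal_coeff (shifted_col n A k) l) | _ \<Rightarrow> 0)
     else if X = ''T'' then (case is of [t, i, j] \<Rightarrow> toeplitz_factor n A t $$ (i, j) | _ \<Rightarrow> 0)
     else if X = ''P'' then (case is of [k, i, j] \<Rightarrow> cyclic_mat n $$ (i, j) | _ \<Rightarrow> 0)
     else 0)"

lemma final_store_simps:
  "final_store n A ''A'' [i, j] = A $$ (i, j)"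
  "final_store n A ''e'' [m] = (if m = 0 then 1 else 0)"
  "final_store n A ''B'' [k, i, j] = elim n A k i j"
  "final_store n A ''C'' [k, m] = (if m < n then 0 else shifted_col n A k (m - n))"
  "final_store n A ''D'' [k, m] =
     (if m < n then 0 else reciprocal_coeff (shifted_col n A k) (m - n))"
  "final_store n A ''S'' [k, i, j] =
     (\<Sum>l<j. shifted_col n A k (i - l) * reciprocal_coeff (shifted_col n A k) l)"
  "final_store n A ''T'' [t, i, j] = toeplitz_factor n A t $$ (i, j)"
  "final_store n A ''P'' [k, i, j] = cyclic_mat n $$ (i, j)"
  by (simp_all add: final_store_def)

definition idx :: "nat \<Rightarrow> nat \<Rightarrow> nat \<Rightarrow> nat \<Rightarrow> index_store" where
  "idx n k i j = (\<lambda>_. 0)(''n'' := n, ''k'' := k, ''i'' := i, ''j'' := j)"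

lemma idx_simps [simp]:
  "idx n k i j ''n'' = n" "idx n k i j ''k'' = k" "idx n k i j ''i'' = i" "idx n k i j ''j'' = j"
  "(idx n k i j)(''k'' := x) = idx n x i j"
  "(idx n k i j)(''i'' := x) = idx n k x j"
  "(idx n k i j)(''j'' := x) = idx n k i x"
  by (auto simp: idx_def)

definition block :: "string \<Rightarrow> nat \<Rightarrow> nat \<Rightarrow> (string \<times> nat list) set" where
  "block X t n = (\<Union>i<n. \<Union>j<n. {(X, [t, i, j])})"

lemma block_iff: "(Y, is) \<in> block X t n \<longleftrightarrow> Y = X \<and> (\<exists>i<n. \<exists>j<n. is = [t, i, j])"
  by (auto simp: block_def)

text \<open>For matrices whose entries are all computed from cells that are final before the loop.\<close>

lemma computes_block:
  assumes "\<And>i j. ival a (idx n k i j) = t"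
    and "\<And>i j \<sigma>. i < n \<Longrightarrow> j < n \<Longrightarrow> agrees F R \<sigma> \<Longrightarrow>
      cval e (idx n k i j, \<sigma>) = Some (F X [t, i, j])"
  shows "computes F (block_prog X a e) (idx n k 0 0) R (block X t n) (n * (n * arith_ops e))"
  unfolding block_prog_def block_def
proof (rule computes_For)
  fix i assume i: "i < n"
  show "computes F (For ''j'' vn (Assign (X, [a, vi, vj]) e)) ((idx n k 0 0)(''i'' := i))
      (R \<union> (\<Union>i'<i. \<Union>j<n. {(X, [t, i', j])})) (\<Union>j<n. {(X, [t, i, j])}) (n * arith_ops e)"
    by (rule computes_For)
       (auto intro!: computes_assign assms(2) i simp: assms(1) elim!: agrees_mono)
qed simp_all

lemma step_cost:
  "n * 1 + (n * (n * 2 + 2) + (n * (n * 0) + (n * (n * 1) + (n * (n * 1) +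
    (n * 1 + (n - 1) * (n * 2)))))) \<le> 10 * n ^ 2" for n :: nat
proof -
  define r where "r = (n - 1) * (n * 2)"
  have "r \<le> n * (n * 2)" unfolding r_def by (rule mult_right_mono) simp_all
  moreover have "n \<le> n * n" by simp
  ultimately have "n * 1 + (n * (n * 2 + 2) + (n * (n * 0) + (n * (n * 1) + (n * (n * 1) +
      (n * 1 + r))))) \<le> 10 * (n * n)"
    unfolding distrib_left mult_1_right mult_0_right mult.assoc[symmetric] by linarith
  then show ?thesis unfolding r_def power2_eq_square .
qed

context
  fixes n k :: nat and A :: "complex mat"
  assumes A: "eliminable n n A" and k: "k < n"
begin

lemma computes_column:
  assumes R: "\<And>i j. i < n \<Longrightarrow> j < n \<Longrightarrow> (''B'', [k, i, j]) \<in> R" "\<And>m. (''e'', [m]) \<in> R"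
  shows "computes (final_store n A) column_prog (idx n k 0 0) R
    (\<Union>i<n. {(''C'', [k, n + i])}) (n * 1)"
  unfolding column_prog_def
proof (rule computes_For)
  fix i assume i: "i < n"
  show "computes (final_store n A) (Assign (''C'', [vk, IAdd vn vi])
     (Arith Sub (Read (''B'', [vk, vi, vpivot])) (Read (''e'', [ISub vlast vi]))))
     ((idx n k 0 0)(''i'' := i)) (R \<union> (\<Union>i'<i. {(''C'', [k, n + i'])})) {(''C'', [k, n + i])} 1"
  proof (rule computes_weaken[OF computes_assign])
    fix \<sigma> assume "agrees (final_store n A) (R \<union> (\<Union>i'<i. {(''C'', [k, n + i'])})) \<sigma>"
    from agrees_mono[OF this] have "agrees (final_store n A) R \<sigma>" by simp
    from agreesD[OF this] show "cval (Arith Sub (Read (''B'', [vk, vi, vpivot]))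
        (Read (''e'', [ISub vlast vi]))) ((idx n k 0 0)(''i'' := i), \<sigma>) =
        Some (final_store n A ''C'' [k, n + i])"
      using R i k by (auto simp: read_cell_def address_def final_store_simps shifted_col_def)
  qed simp_all
qed simp_all

lemma computes_reciprocal:
  assumes R: "\<And>m. m < 2 * n \<Longrightarrow> (''C'', [k, m]) \<in> R" "\<And>m. (''e'', [m]) \<in> R"
    "\<And>i. (''S'', [k, i, 0]) \<in> R"
  shows "computes (final_store n A) reciprocal_prog (idx n k 0 0) R
    (\<Union>i<n. (\<Union>j<i. {(''S'', [k, i, Suc j])}) \<union> {(''D'', [k, n + i])}) (n * (n * 2 + 2))"
  unfolding reciprocal_prog_def
proof (rule computes_For)
  fix i assume i: "i < n"
  let ?F = "final_store n A"
  let ?R = "R \<union> (\<Union>i'<i. (\<Union>j<i'. {(''S'', [k, i', Suc j])}) \<union> {(''D'', [k, n + i'])})"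
  let ?inner = "Assign (''S'', [vk, vi, vsuc vj])
       (Arith Add (Read (''S'', [vk, vi, vj]))
         (Arith Mul (Read (''C'', [vk, IAdd vn (ISub vi vj)])) (Read (''D'', [vk, IAdd vn vj]))))"
  let ?outer = "Assign (''D'', [vk, IAdd vn vi])
       (Arith Div (Arith Sub (Read (''e'', [vi])) (Read (''S'', [vk, vi, vi])))
         (Read (''C'', [vk, vn])))"
  let ?v = "idx n k i 0"
  have inner: "computes ?F (For ''j'' vi ?inner) ?v ?R (\<Union>j<i. {(''S'', [k, i, Suc j])}) (i * 2)"
  proof (rule computes_For)
    fix j assume j: "j < i"
    let ?R' = "?R \<union> (\<Union>j'<j. {(''S'', [k, i, Suc j'])})"
    show "computes ?F ?inner (?v(''j'' := j)) ?R' {(''S'', [k, i, Suc j])} 2"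
    proof (rule computes_weaken[OF computes_assign])
      fix \<sigma> assume "agrees ?F ?R' \<sigma>"
      note * = agreesD[OF this]
      \<comment> \<open>The empty partial sum is 0 and thus final from the start; the others come from earlier rounds.\<close>
      have "(''S'', [k, i, j]) \<in> ?R'" using R(3) by (cases j) auto
      moreover have "(''C'', [k, n + (i - j)]) \<in> ?R'" using R(1) i by simp
      moreover have "(''D'', [k, n + j]) \<in> ?R'" using j by auto
      ultimately show "cval (Arith Add (Read (''S'', [vk, vi, vj]))
         (Arith Mul (Read (''C'', [vk, IAdd vn (ISub vi vj)])) (Read (''D'', [vk, IAdd vn vj]))))
          (?v(''j'' := j), \<sigma>) = Some (?F ''S'' [k, i, Suc j])"
        by (simp add: * read_cell_def address_def final_store_simps del: Un_iff UN_iff)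
    qed simp_all
  qed simp_all
  let ?R2 = "?R \<union> (\<Union>j<i. {(''S'', [k, i, Suc j])})"
  have outer: "computes ?F ?outer ?v ?R2 {(''D'', [k, n + i])} 2"
  proof (rule computes_weaken[OF computes_assign])
    fix \<sigma> assume "agrees ?F ?R2 \<sigma>"
    note * = agreesD[OF this]
    have "(''S'', [k, i, i]) \<in> ?R2" using R(3) by (cases i) auto
    moreover have "(''C'', [k, n]) \<in> ?R2" "(''e'', [i]) \<in> ?R2" using R i by simp_all
    moreover have "shifted_col n A k 0 \<noteq> 0" using A k by (simp add: eliminable_def)
    ultimately show "cval (Arith Div (Arith Sub (Read (''e'', [vi])) (Read (''S'', [vk, vi, vi])))
         (Read (''C'', [vk, vn]))) (?v, \<sigma>) = Some (?F ''D'' [k, n + i])"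
      by (simp add: * read_cell_def address_def final_store_simps
          reciprocal_coeff.simps[of _ i] del: Un_iff UN_iff)
  qed simp_all
  show "computes ?F (Seq (For ''j'' vi ?inner) ?outer) ((idx n k 0 0)(''i'' := i)) ?R
      ((\<Union>j<i. {(''S'', [k, i, Suc j])}) \<union> {(''D'', [k, n + i])}) (n * 2 + 2)"
    using computes_weaken[OF computes_seq[OF inner outer] order_refl] i by simp
qed simp_all

lemma computes_first_factor:
  assumes R: "\<And>m. m < 2 * n \<Longrightarrow> (''C'', [k, m]) \<in> R"
  shows "computes (final_store n A) first_factor_prog (idx n k 0 0) R
    (block ''T'' (2 * k + 1) n) (n * (n * 0))"
  unfolding first_factor_prog_def
proof (rule computes_weaken[OF computes_block])
  fix i j \<sigma> assume ij: "i < n" "j < n" and "agrees (final_store n A) R \<sigma>"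
  note * = agreesD[OF this(3)]
  have "(''C'', [k, n + i - j]) \<in> R" using R ij by simp
  then show "cval (Read (''C'', [vk, ISub (IAdd vn vi) vj])) (idx n k i j, \<sigma>) =
      Some (final_store n A ''T'' [2 * k + 1, i, j])"
    using ij by (auto simp: * read_cell_def address_def final_store_simps toeplitz_factor
        lower_toeplitz_def)
qed simp_all

lemma computes_second_factor:
  assumes R: "\<And>m. m < 2 * n \<Longrightarrow> (''D'', [k, m]) \<in> R" "\<And>m. (''e'', [m]) \<in> R"
  shows "computes (final_store n A) second_factor_prog (idx n k 0 0) R
    (block ''T'' (2 * k + 2) n) (n * (n * 1))"
  unfolding second_factor_prog_def
proof (rule computes_weaken[OF computes_block])
  fix i j \<sigma> assume ij: "i < n" "j < n" and "agrees (final_store n A) R \<sigma>"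
  note * = agreesD[OF this(3)]
  have "(''D'', [k, n + i - j]) \<in> R" using R ij by simp
  then show "cval (Arith Add (Read (''D'', [vk, ISub (IAdd vn vi) vj]))
       (Read (''e'', [IAdd vi (ISub vlast vj)]))) (idx n k i j, \<sigma>) =
      Some (final_store n A ''T'' [2 * k + 2, i, j])"
    using ij R(2) by (auto simp: * read_cell_def address_def final_store_simps toeplitz_factor
        lower_toeplitz_def corner_mat_def)
qed simp_all

lemma computes_permutation:
  assumes R: "\<And>m. (''e'', [m]) \<in> R"
  shows "computes (final_store n A) permutation_prog (idx n k 0 0) R
    (block ''P'' (k + 1) n) (n * (n * 1))"
  unfolding permutation_prog_def
proof (rule computes_weaken[OF computes_block])
  fix i j \<sigma> assume ij: "i < n" "j < n" and "agrees (final_store n A) R \<sigma>"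
  note * = agreesD[OF this(3)]
  show "cval (Arith Add (Read (''e'', [IAdd (ISub (vsuc vi) vj) (ISub vj (vsuc vi))]))
       (Read (''e'', [IAdd (ISub vlast vi) vj]))) (idx n k i j, \<sigma>) =
      Some (final_store n A ''P'' [k + 1, i, j])"
    using ij R by (auto simp: * read_cell_def address_def final_store_simps cyclic_mat_def)
qed simp_all

lemma computes_pivot_row:
  assumes R: "\<And>i j. i < n \<Longrightarrow> j < n \<Longrightarrow> (''B'', [k, i, j]) \<in> R"
  shows "computes (final_store n A) pivot_row_prog (idx n k 0 0) R
    (\<Union>j<n. {(''B'', [k + 1, 0, j])}) (n * 1)"
  unfolding pivot_row_prog_def
proof (rule computes_For)
  fix j assume j: "j < n"
  let ?R = "R \<union> (\<Union>j'<j. {(''B'', [k + 1, 0, j'])})"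
  show "computes (final_store n A) (Assign (''B'', [vsuc vk, IConst 0, vj])
     (Arith Div (Read (''B'', [vk, vlast, vj])) (Read (''B'', [vk, vlast, vpivot]))))
     ((idx n k 0 0)(''j'' := j)) ?R {(''B'', [k + 1, 0, j])} 1"
  proof (rule computes_weaken[OF computes_assign])
    fix \<sigma> assume "agrees (final_store n A) ?R \<sigma>"
    note * = agreesD[OF this]
    have "(''B'', [k, n - 1, j]) \<in> ?R" "(''B'', [k, n - 1, n - 1 - k]) \<in> ?R"
      using R j by simp_all
    moreover have "elim n A k (n - 1) (n - 1 - k) \<noteq> 0" using A k by (simp add: eliminable_def)
    ultimately show "cval (Arith Div (Read (''B'', [vk, vlast, vj]))
        (Read (''B'', [vk, vlast, vpivot]))) ((idx n k 0 0)(''j'' := j), \<sigma>) =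
        Some (final_store n A ''B'' [k + 1, 0, j])"
      by (simp add: * read_cell_def address_def final_store_simps elim_Suc_0
          del: Un_iff UN_iff)
  qed simp_all
qed simp_all

lemma computes_other_rows:
  assumes R: "\<And>i j. i < n \<Longrightarrow> j < n \<Longrightarrow> (''B'', [k, i, j]) \<in> R"
    "\<And>j. j < n \<Longrightarrow> (''B'', [k + 1, 0, j]) \<in> R"
  shows "computes (final_store n A) other_rows_prog (idx n k 0 0) R
    (\<Union>i<n - 1. \<Union>j<n. {(''B'', [k + 1, i + 1, j])}) ((n - 1) * (n * 2))"
  unfolding other_rows_prog_def
proof (rule computes_For)
  fix i assume i: "i < n - 1"
  let ?R = "R \<union> (\<Union>i'<i. \<Union>j<n. {(''B'', [k + 1, i' + 1, j])})"
  let ?e = "Arith Sub (Read (''B'', [vk, vi, vj]))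
       (Arith Mul (Read (''B'', [vk, vi, vpivot])) (Read (''B'', [vsuc vk, IConst 0, vj])))"
  show "computes (final_store n A) (For ''j'' vn (Assign (''B'', [vsuc vk, vsuc vi, vj]) ?e))
      ((idx n k 0 0)(''i'' := i)) ?R (\<Union>j<n. {(''B'', [k + 1, i + 1, j])}) (n * 2)"
  proof (rule computes_For)
    fix j assume j: "j < n"
    let ?R' = "?R \<union> (\<Union>j'<j. {(''B'', [k + 1, i + 1, j'])})"
    show "computes (final_store n A) (Assign (''B'', [vsuc vk, vsuc vi, vj]) ?e)
        ((idx n k 0 0)(''i'' := i, ''j'' := j)) ?R' {(''B'', [k + 1, i + 1, j])} 2"
    proof (rule computes_weaken[OF computes_assign])
      fix \<sigma> assume "agrees (final_store n A) ?R' \<sigma>"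
      from agrees_mono[OF this, of R] have "agrees (final_store n A) R \<sigma>" by auto
      note * = agreesD[OF this]
      have "(''B'', [k, i, j]) \<in> R" "(''B'', [k, i, n - Suc k]) \<in> R" "(''B'', [Suc k, 0, j]) \<in> R"
        using R(1)[of i j] R(1)[of i "n - Suc k"] R(2)[OF j] i j by simp_all
      then show "cval ?e ((idx n k 0 0)(''i'' := i, ''j'' := j), \<sigma>) =
          Some (final_store n A ''B'' [k + 1, i + 1, j])"
        by (simp add: * read_cell_def address_def final_store_simps elim_Suc_Suc)
    qed simp_all
  qed simp_all
qed simp_all

lemma computes_step:
  assumes R: "\<And>i j. i < n \<Longrightarrow> j < n \<Longrightarrow> (''B'', [k, i, j]) \<in> R" "\<And>m. (''e'', [m]) \<in> R"
    "\<And>m. m < n \<Longrightarrow> (''C'', [k, m]) \<in> R" "\<And>m. m < n \<Longrightarrow> (''D'', [k, m]) \<in> R"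
    "\<And>i. (''S'', [k, i, 0]) \<in> R"
  shows "computes (final_store n A) step_prog (idx n k 0 0) R
    (block ''T'' (2 * k + 1) n \<union> block ''T'' (2 * k + 2) n \<union> block ''P'' (k + 1) n \<union>
     block ''B'' (k + 1) n) (10 * n ^ 2)"
proof -
  let ?F = "final_store n A" and ?v = "idx n k 0 0"
  let ?C = "\<Union>i<n. {(''C'', [k, n + i])}"
  let ?D = "\<Union>i<n. (\<Union>j<i. {(''S'', [k, i, Suc j])}) \<union> {(''D'', [k, n + i])}"
  let ?T1 = "block ''T'' (2 * k + 1) n" and ?T2 = "block ''T'' (2 * k + 2) n"
  let ?P = "block ''P'' (k + 1) n"
  let ?B0 = "\<Union>j<n. {(''B'', [k + 1, 0, j])}"
  let ?B1 = "\<Union>i<n - 1. \<Union>j<n. {(''B'', [k + 1, i + 1, j])}"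
  have split: "m < n \<or> (\<exists>i<n. m = n + i)" if "m < 2 * n" for m
    using that by presburger
  have C: "(''C'', [k, m]) \<in> R \<union> ?C" if "m < 2 * n" for m
    using split[OF that] R(3) by auto
  have D: "(''D'', [k, m]) \<in> R \<union> ?D" if "m < 2 * n" for m
    using split[OF that] R(4) by auto
  have "computes ?F step_prog ?v R (?C \<union> (?D \<union> (?T1 \<union> (?T2 \<union> (?P \<union> (?B0 \<union> ?B1))))))
      (n * 1 + (n * (n * 2 + 2) + (n * (n * 0) + (n * (n * 1) + (n * (n * 1) +
        (n * 1 + (n - 1) * (n * 2)))))))"
    unfolding step_prog_def
  proof (intro computes_seq)
    show "computes ?F column_prog ?v R ?C (n * 1)"
      by (intro computes_column R)
    show "computes ?F reciprocal_prog ?v (R \<union> ?C) ?D (n * (n * 2 + 2))"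
      by (intro computes_reciprocal C UnI1 R)
    show "computes ?F first_factor_prog ?v (R \<union> ?C \<union> ?D) ?T1 (n * (n * 0))"
      using C by (intro computes_first_factor UnI1[of _ "R \<union> ?C" ?D])
    show "computes ?F second_factor_prog ?v (R \<union> ?C \<union> ?D \<union> ?T1) ?T2 (n * (n * 1))"
      using D R(2) by (intro computes_second_factor) blast+
    show "computes ?F permutation_prog ?v (R \<union> ?C \<union> ?D \<union> ?T1 \<union> ?T2) ?P (n * (n * 1))"
      by (intro computes_permutation UnI1 R)
    show "computes ?F pivot_row_prog ?v (R \<union> ?C \<union> ?D \<union> ?T1 \<union> ?T2 \<union> ?P) ?B0 (n * 1)"
      by (intro computes_pivot_row UnI1 R)
    show "computes ?F other_rows_prog ?v (R \<union> ?C \<union> ?D \<union> ?T1 \<union> ?T2 \<union> ?P \<union> ?B0) ?B1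
        ((n - 1) * (n * 2))"
    proof (rule computes_other_rows)
      fix j assume "j < n"
      then have "(''B'', [k + 1, 0, j]) \<in> ?B0" by simp
      then show "(''B'', [k + 1, 0, j]) \<in> R \<union> ?C \<union> ?D \<union> ?T1 \<union> ?T2 \<union> ?P \<union> ?B0"
        by (rule UnI2)
    qed (intro UnI1 R)
  qed
  then show ?thesis
  proof (rule computes_weaken)
    have "block ''B'' (k + 1) n \<subseteq> ?B0 \<union> ?B1"
    proof
      fix x assume "x \<in> block ''B'' (k + 1) n"
      then obtain i j where "i < n" "j < n" "x = (''B'', [k + 1, i, j])"
        by (auto simp: block_def)
      then show "x \<in> ?B0 \<union> ?B1" by (cases i) auto
    qed
    moreover have "t \<union> t' \<union> p \<union> b \<subseteq> c \<union> (d \<union> (t \<union> (t' \<union> (p \<union> b'))))" if "b \<subseteq> b'"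
      for t t' p b b' c d :: "(string \<times> nat list) set"
      using that by blast
    ultimately show "?T1 \<union> ?T2 \<union> ?P \<union> block ''B'' (k + 1) n \<subseteq>
        ?C \<union> (?D \<union> (?T1 \<union> (?T2 \<union> (?P \<union> (?B0 \<union> ?B1)))))" by simp
  qed (rule step_cost)
qed

end

lemma input_state_idx: "fst (input_state n A) = idx n 0 0 0"
  by (auto simp: input_state_def idx_def)

text \<open>Besides the input, the initial set \<open>R\<close> provides the zeros on which the loops rely: array \<open>e\<close> away from
index 0, the empty partial sums, and the cells of \<open>C\<close> and \<open>D\<close> below the offset.\<close>

lemma computes_factor:
  assumes A: "eliminable n n A"
  defines "R \<equiv> {(X, is). snd (input_state n A) X is = final_store n A X is}"
  shows "computes (final_store n A) factor_prog (idx n 0 0 0) R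
    (\<Union>k<n. block ''T'' (2 * k + 1) n \<union> block ''T'' (2 * k + 2) n \<union> block ''P'' (k + 1) n)
    (10 * n ^ 3)"
proof -
  let ?F = "final_store n A" and ?v = "idx n 0 0 0"
  let ?E = "{(''e'', [0])} :: (string \<times> nat list) set"
  let ?B = "block ''B'' 0 n"
  let ?W = "\<lambda>k. block ''T'' (2 * k + 1) n \<union> block ''T'' (2 * k + 2) n \<union>
    block ''P'' (k + 1) n \<union> block ''B'' (k + 1) n"
  have R: "m > 0 \<Longrightarrow> (''e'', [m]) \<in> R" "i < n \<Longrightarrow> j < n \<Longrightarrow> (''A'', [i, j]) \<in> R"
    "m < n \<Longrightarrow> (''C'', [k, m]) \<in> R" "m < n \<Longrightarrow> (''D'', [k, m]) \<in> R"
    "(''S'', [k, i, 0]) \<in> R" for m i j k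
    by (simp_all add: R_def input_state_def final_store_simps)
  have "computes ?F (Assign (''e'', [IConst 0]) One) ?v R ?E 0"
    by (rule computes_weaken[OF computes_assign]) (simp_all add: final_store_simps)
  moreover have "computes ?F (block_prog ''B'' (IConst 0) (Read (''A'', [vi, vj]))) ?v
      (R \<union> ?E) ?B 0"
  proof (rule computes_weaken[OF computes_block])
    fix i j \<sigma> assume ij: "i < n" "j < n" and "agrees ?F (R \<union> ?E) \<sigma>"
    from agreesD[OF this(3)] R(2)[OF ij]
    show "cval (Read (''A'', [vi, vj])) (idx n 0 i j, \<sigma>) = Some (?F ''B'' [0, i, j])"
      by (simp add: read_cell_def address_def final_store_simps)
  qed simp_all
  ultimately have load: "computes ?F load_prog ?v R (?E \<union> ?B) (0 + 0)"
    unfolding load_prog_def block_prog_def[symmetric] by (rule computes_seq)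
  have "computes ?F (For ''k'' vn step_prog) ?v (R \<union> (?E \<union> ?B)) (\<Union>k<n. ?W k) (n * (10 * n ^ 2))"
  proof (rule computes_For)
    fix k assume k: "k < n"
    let ?R = "R \<union> (?E \<union> ?B) \<union> (\<Union>j<k. ?W j)"
    have "(''B'', [k, i, j]) \<in> ?R" if "i < n" "j < n" for i j
    proof (cases k)
      case 0
      with that show ?thesis by (simp add: block_iff)
    next
      case (Suc k')
      with that have "(''B'', [k, i, j]) \<in> ?W k'" by (simp add: block_iff)
      with Suc show ?thesis by blast
    qed
    moreover have "(''e'', [m]) \<in> ?R" for m using R(1) by (cases m) simp_all
    ultimately show "computes ?F step_prog (?v(''k'' := k)) ?R (?W k) (10 * n ^ 2)"
      unfolding idx_simps by (intro computes_step A k) (simp_all add: R)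
  qed simp_all
  from computes_seq[OF load this] show ?thesis
    unfolding factor_prog_def
    by (rule computes_weaken) (auto simp: power2_eq_square power3_eq_cube)
qed

theorem mainTheorem10:
  shows "\<exists>(alg :: program) (cost :: nat \<Rightarrow> nat).
    (\<lambda>n. real (cost n)) \<in> O(\<lambda>n. real n ^ 3) \<and>
    (\<forall>n\<ge>1. holds_generically n (\<lambda>A.
       \<exists>t s'. exec alg (input_state n A) t s' \<and> t \<le> cost n \<and>
         (\<forall>k\<in>{1..2 * n}. toeplitz_mat n (output_mat n s' ''T'' k)) \<and>
         (\<forall>k\<in>{1..n}. permutation_mat n (output_mat n s' ''P'' k)) \<and>
         A = toeplitz_perm_product n (output_mat n s' ''T'') (output_mat n s' ''P'') n))"
proof (intro exI[of _ factor_prog] exI[of _ "\<lambda>n. 10 * n ^ 3"] conjI allI impI)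
  show "(\<lambda>n. real (10 * n ^ 3)) \<in> O(\<lambda>n. real n ^ 3)" by simp
next
  fix n :: nat assume "n \<ge> 1"
  show "holds_generically n (\<lambda>A.
       \<exists>t s'. exec factor_prog (input_state n A) t s' \<and> t \<le> 10 * n ^ 3 \<and>
         (\<forall>k\<in>{1..2 * n}. toeplitz_mat n (output_mat n s' ''T'' k)) \<and>
         (\<forall>k\<in>{1..n}. permutation_mat n (output_mat n s' ''P'' k)) \<and>
         A = toeplitz_perm_product n (output_mat n s' ''T'') (output_mat n s' ''P'') n)"
  proof (rule generically_eliminable)
    fix A :: "complex mat" assume A: "A \<in> carrier_mat n n" "eliminable n n A"
    let ?W = "\<Union>k<n. block ''T'' (2 * k + 1) n \<union> block ''T'' (2 * k + 2) n \<union> block ''P'' (k + 1) n"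
    have "agrees (final_store n A)
        {(X, is). snd (input_state n A) X is = final_store n A X is} (snd (input_state n A))"
      by (auto simp: agrees_def)
    then obtain t \<sigma> where run: "exec factor_prog (idx n 0 0 0, snd (input_state n A)) t (idx n 0 0 0, \<sigma>)"
        "t \<le> 10 * n ^ 3"
      and \<sigma>: "agrees (final_store n A)
        ({(X, is). snd (input_state n A) X is = final_store n A X is} \<union> ?W) \<sigma>"
      using computes_factor[OF A(2)] unfolding computes_def by blast
    let ?T = "output_mat n (idx n 0 0 0, \<sigma>) ''T''" and ?P = "output_mat n (idx n 0 0 0, \<sigma>) ''P''"
    have \<sigma>W: "\<sigma> X is = final_store n A X is" if "(X, is) \<in> ?W" for X "is"
      using agreesD[OF \<sigma>] that by blast
    have T1: "?T (2 * k + 1) = lower_toeplitz n (shifted_col n A k)" if "k < n" for k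
    proof (rule eq_matI)
      fix i j assume "i < dim_row (lower_toeplitz n (shifted_col n A k))"
        "j < dim_col (lower_toeplitz n (shifted_col n A k))"
      then have ij: "i < n" "j < n" by simp_all
      then have "(''T'', [2 * k + 1, i, j]) \<in> block ''T'' (2 * k + 1) n" by (simp add: block_iff)
      then have "(''T'', [2 * k + 1, i, j]) \<in> ?W" using that by blast
      from \<sigma>W[OF this] ij show "?T (2 * k + 1) $$ (i, j) = lower_toeplitz n (shifted_col n A k) $$ (i, j)"
        by (simp add: output_mat_def final_store_simps toeplitz_factor)
    qed (simp_all add: output_mat_def)
    have T2: "?T (2 * k + 2) =
        lower_toeplitz n (reciprocal_coeff (shifted_col n A k)) + corner_mat n" (is "_ = ?M")
      if "k < n" for k
    proof (rule eq_matI)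
      fix i j assume "i < dim_row ?M" "j < dim_col ?M"
      then have ij: "i < n" "j < n" by simp_all
      then have "(''T'', [2 * k + 2, i, j]) \<in> block ''T'' (2 * k + 2) n" by (simp add: block_iff)
      then have "(''T'', [2 * k + 2, i, j]) \<in> ?W" using that by blast
      from \<sigma>W[OF this] ij show "?T (2 * k + 2) $$ (i, j) = ?M $$ (i, j)"
        by (simp add: output_mat_def final_store_simps toeplitz_factor)
    qed (simp_all add: output_mat_def)
    have P: "?P (k + 1) = cyclic_mat n" if "k < n" for k
    proof (rule eq_matI)
      fix i j assume "i < dim_row (cyclic_mat n)" "j < dim_col (cyclic_mat n)"
      then have ij: "i < n" "j < n" by (simp_all add: cyclic_mat_def)
      then have "(''P'', [k + 1, i, j]) \<in> block ''P'' (k + 1) n" by (simp add: block_iff)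
      then have "(''P'', [k + 1, i, j]) \<in> ?W" using that by blast
      from \<sigma>W[OF this] ij show "?P (k + 1) $$ (i, j) = cyclic_mat n $$ (i, j)"
        by (simp add: output_mat_def final_store_simps)
    qed (simp_all add: output_mat_def cyclic_mat_def)
    have "toeplitz_mat n (?T m)" if "m \<in> {1..2 * n}" for m
    proof -
      define k where "k = (m - 1) div 2"
      have "k < n" "m = 2 * k + 1 \<or> m = 2 * k + 2"
        using that unfolding k_def atLeastAtMost_iff by presburger+
      then show ?thesis
        using T1 T2 toeplitz_lower_toeplitz toeplitz_add toeplitz_corner_mat by metis
    qed
    moreover have "permutation_mat n (?P m)" if "m \<in> {1..n}" for m
    proof -
      have "m - 1 < n" "m - 1 + 1 = m" using that by auto
      with P[of "m - 1"] show ?thesis by (simp add: permutation_cyclic_mat)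
    qed
    moreover have "A = toeplitz_perm_product n ?T ?P n"
      using toeplitz_perm_product_elim[of A n n ?T ?P, OF A order_refl T1 T2 P]
        elim_mat_final[OF A(2)] by auto
    moreover have "exec factor_prog (input_state n A) t (idx n 0 0 0, \<sigma>)"
      using run(1) unfolding input_state_idx[of n A, symmetric] by simp
    ultimately show "\<exists>t s'. exec factor_prog (input_state n A) t s' \<and> t \<le> 10 * n ^ 3 \<and>
         (\<forall>k\<in>{1..2 * n}. toeplitz_mat n (output_mat n s' ''T'' k)) \<and>
         (\<forall>k\<in>{1..n}. permutation_mat n (output_mat n s' ''P'' k)) \<and>
         A = toeplitz_perm_product n (output_mat n s' ''T'') (output_mat n s' ''P'') n"
      using run(2) by blast
  qed
qed

end
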